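(* Let $n$ be a positive integer and let $W_n$ be the set of all vectors $\vec p=(p_1,\dots,p_l)$ (any length $l\ge1$) of positive integers with $p_1+\dots+p_l=n$. Then $$\mathop{\rm Le}\nolimits_{\langle1\rangle_n}(-1)=\sum_{\vec p\in W_n}\mathop{\rm Li}\nolimits_{\vec p}(-1)=-\mathop{\rm Li}\nolimits_n\!\left(\tfrac12\right),$$ $$\mathop{\rm Li}\nolimits_{\langle1\rangle_n}(-1)=\sum_{\vec p\in W_n}(-1)^{n-l(\vec p)}\mathop{\rm Le}\nolimits_{\vec p}(-1)=\frac{(-\ln2)^n}{n!}.$$
   Context: For positive integers $s_1,\dots,s_l$ and $|z|<1$: $\mathop{\rm Li}\nolimits_{s_1,\dots,s_l}(z)=\sum_{n_1>\dots>n_l\ge1}\frac{z^{n_1}}{n_1^{s_1}\cdots n_l^{s_l}}$, $\mathop{\rm Le}\nolimits_{s_1,\dots,s_l}(z)=\sum_{n_1\ge\dots\ge n_l\ge1}\frac{z^{n_1}}{n_1^{s_1}\cdots n_l^{s_l}}$. Both extend analytically to $D=\mathbb{C}\setminus[1,+\infty)$, which contains $-1$; values at $-1$ mean this continuation. $\langle1\rangle_n$ is the $n$-dimensional vector of ones and $l(\vec p)$ the length of $\vec p$. *)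

theory Defs
  imports "HOL-Complex_Analysis.Complex_Analysis"
begin

text \<open>
  Index vectors are lists of naturals, always nonempty with positive entries below.
  The two series converge absolutely for \<open>norm z < 1\<close>, so the unordered sum
  over the index lists \<open>[n\<^sub>1, \<dots>, n\<^sub>l]\<close> is the intended one.
\<close>

definition Li_series :: "nat list \<Rightarrow> complex \<Rightarrow> complex" where
  "Li_series s z =
     (\<Sum>\<^sub>\<infinity>ns\<in>{ns. length ns = length s \<and> sorted_wrt (>) ns \<and> (\<forall>m\<in>set ns. m \<ge> 1)}.
        z ^ hd ns / (\<Prod>i<length s. of_nat (ns ! i) ^ (s ! i)))"

definition Le_series :: "nat list \<Rightarrow> complex \<Rightarrow> complex" where
  "Le_series s z =
     (\<Sum>\<^sub>\<infinity>ns\<in>{ns. length ns = length s \<and> sorted_wrt (\<ge>) ns \<and> (\<forall>m\<in>set ns. m \<ge> 1)}.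
        z ^ hd ns / (\<Prod>i<length s. of_nat (ns ! i) ^ (s ! i)))"

definition slit_plane :: "complex set" where
  "slit_plane = - (complex_of_real ` {1..})"

text \<open>
  The value at \<open>z\<close> of the holomorphic continuation of \<open>F\<close> from the open unit disc to the
  slit plane. The value is unique for \<open>z\<close> in the slit plane as soon as a continuation
  exists (lemma \<open>slit_continuation_eq\<close>); it is unspecified otherwise.
\<close>

definition slit_continuation :: "(complex \<Rightarrow> complex) \<Rightarrow> complex \<Rightarrow> complex" where
  "slit_continuation F z =
     (THE w. \<exists>f. f holomorphic_on slit_plane \<and> (\<forall>u\<in>ball 0 1. f u = F u) \<and> w = f z)"

definition Li :: "nat list \<Rightarrow> complex \<Rightarrow> complex" where
  "Li s = slit_continuation (Li_series s)"

definition Le :: "nat list \<Rightarrow> complex \<Rightarrow> complex" where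
  "Le s = slit_continuation (Le_series s)"

definition compositions :: "nat \<Rightarrow> nat list set" where
  "compositions n = {p. p \<noteq> [] \<and> (\<forall>x\<in>set p. x > 0) \<and> sum_list p = n}"

lemma open_slit_plane: "open slit_plane"
proof -
  have "slit_plane = - (\<real> \<inter> {z. Re z \<ge> 1})"
    unfolding slit_plane_def by (auto simp: image_iff complex_is_Real_iff complex_eq_iff)
  moreover have "closed (\<real> \<inter> {z. Re z \<ge> 1})"
    by (intro closed_Int closed_complex_Reals closed_halfspace_Re_ge)
  ultimately show ?thesis by (metis open_Compl)
qed

lemma connected_slit_plane: "connected slit_plane"
proof (rule starlike_imp_connected, unfold starlike_def, intro bexI ballI subsetI)
  show "0 \<in> slit_plane" by (auto simp: slit_plane_def)
  fix x y assume x: "x \<in> slit_plane" and y: "y \<in> closed_segment 0 x"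
  from y obtain u where u: "0 \<le> u" "u \<le> 1" "y = of_real u * x"
    by (auto simp: closed_segment_def scaleR_conv_of_real)
  show "y \<in> slit_plane"
  proof (rule ccontr)
    assume "y \<notin> slit_plane"
    then obtain t where t: "t \<ge> 1" "y = of_real t" by (auto simp: slit_plane_def)
    with u have "u \<noteq> 0" by auto
    with t u have "x = of_real (t / u)" by (simp add: field_simps)
    moreover have "t / u \<ge> 1" using t u \<open>u \<noteq> 0\<close> by simp
    ultimately show False using x unfolding slit_plane_def by blast
  qed
qed

lemma ball_subset_slit_plane: "ball 0 1 \<subseteq> slit_plane"
  by (auto simp: slit_plane_def)

lemma slit_continuation_eq:
  assumes "f holomorphic_on slit_plane" "\<And>u. u \<in> ball 0 1 \<Longrightarrow> f u = F u" "z \<in> slit_plane"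
  shows "slit_continuation F z = f z"
  unfolding slit_continuation_def
proof (rule the_equality)
  fix w assume "\<exists>g. g holomorphic_on slit_plane \<and> (\<forall>u\<in>ball 0 1. g u = F u) \<and> w = g z"
  then obtain g where g: "g holomorphic_on slit_plane" "\<And>u. u \<in> ball 0 1 \<Longrightarrow> g u = F u" "w = g z"
    by blast
  have "g z = f z"
    by (rule analytic_continuation_open[OF open_ball open_slit_plane _ connected_slit_plane
          ball_subset_slit_plane g(1) assms(1) _ assms(3)]) (use g assms in auto)
  with g show "w = f z" by simp
qed (use assms in blast)

end

theory Submission
  imports Defs
begin

text \<open>
  Prepending an exponent to an index vector multiplies the power series by \<open>z / (1 - z)\<close>
  (for \<open>Li\<close>) or \<open>1 / (1 - z)\<close> (for \<open>Le\<close>) and then inverts \<open>z d/dz\<close> several times. The slit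
  plane is starlike, so both operations preserve the functions holomorphic on it, and all the
  continuations exist. Identities between continuations then follow from identities between
  coefficients, and the sums over compositions come from an induction on \<open>n\<close> in which the
  first part of a composition is either a new \<open>1\<close> or an increased old part.

  Comparing \<open>z d/dz\<close> on both sides gives, by induction on \<open>n\<close>, the closed forms
  \<open>(- Ln (1 - z)) ^ n / n!\<close> for \<open>Li\<close> of \<open>n\<close> ones and \<open>- Li [n] (z / (z - 1))\<close> for \<open>Le\<close> of \<open>n\<close>
  ones. The latter is valid on the whole slit plane because the involution
  \<open>z \<mapsto> z / (z - 1)\<close> maps the slit plane to itself; it sends \<open>-1\<close> to \<open>1 / 2\<close>.
\<close>

section \<open>Index lists and power series coefficients\<close>

definition head0 :: "nat list \<Rightarrow> nat" where
  "head0 ns = (case ns of [] \<Rightarrow> 0 | x # _ \<Rightarrow> x)"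

lemma head0_simps [simp]: "head0 [] = 0" "head0 (x # xs) = x"
  by (simp_all add: head0_def)

definition index_lists :: "(nat \<Rightarrow> nat \<Rightarrow> bool) \<Rightarrow> nat \<Rightarrow> nat list set" where
  "index_lists R l = {ns. length ns = l \<and> sorted_wrt R ns \<and> (\<forall>m\<in>set ns. m \<ge> 1)}"

definition index_lists_from :: "(nat \<Rightarrow> nat \<Rightarrow> bool) \<Rightarrow> nat \<Rightarrow> nat \<Rightarrow> nat list set" where
  "index_lists_from R l N = {ns \<in> index_lists R l. head0 ns = N}"

text \<open>
  The power series coefficients of \<open>Li s\<close> for \<open>R = (>)\<close> and of \<open>Le s\<close> for \<open>R = (\<ge>)\<close>.
  The empty index list is treated as ending in a virtual index \<open>0\<close>, so that the recursion
  starts from the series \<open>1\<close>.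
\<close>

fun mz_coeff :: "(nat \<Rightarrow> nat \<Rightarrow> bool) \<Rightarrow> nat list \<Rightarrow> nat \<Rightarrow> complex" where
  "mz_coeff R [] N = of_bool (N = 0)"
| "mz_coeff R (k # s) N = (if N = 0 then 0 else (\<Sum>m | R N m. mz_coeff R s m) / of_nat N ^ k)"

definition index_weight :: "nat list \<Rightarrow> nat list \<Rightarrow> real" where
  "index_weight s ns = 1 / (\<Prod>i<length s. real (ns ! i) ^ (s ! i))"

lemma index_weight_nonneg: "index_weight s ns \<ge> 0"
  by (simp add: index_weight_def prod_nonneg)

lemma index_weight_Cons: "index_weight (k # s) (N # ns) = index_weight s ns / real N ^ k"
  by (simp add: index_weight_def prod.lessThan_Suc_shift del: prod.lessThan_Suc)

text \<open>What \<open>(>)\<close> and \<open>(\<ge>)\<close> have in common, so that both kinds of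
  series are treated at once. Finiteness makes each coefficient a finite sum, and \<open>bot\<close>
  lets the virtual index 0 follow every positive index.\<close>

locale index_order =
  fixes R :: "nat \<Rightarrow> nat \<Rightarrow> bool"
  assumes trans: "transp R" and fin: "\<And>N. finite {m. R N m}" and bot: "\<And>N. N > 0 \<Longrightarrow> R N 0"
begin

text \<open>By transitivity a new first entry need only be compared with the old one. If there is
  none, \<open>head0\<close> supplies 0 and the comparison holds by \<open>bot\<close>.\<close>

lemma sorted_wrt_Cons_head0:
  assumes "N > 0"
  shows "sorted_wrt R (N # ns) \<longleftrightarrow> R N (head0 ns) \<and> sorted_wrt R ns"
  using assms bot transpD[OF trans] by (cases ns) auto

lemma index_lists_from_Suc:
  "index_lists_from R (Suc l) N =
     (if N = 0 then {} else (\<Union>m\<in>{m. R N m}. (#) N ` index_lists_from R l m))"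
proof (rule set_eqI)
  fix ns
  show "ns \<in> index_lists_from R (Suc l) N \<longleftrightarrow>
    ns \<in> (if N = 0 then {} else (\<Union>m\<in>{m. R N m}. (#) N ` index_lists_from R l m))"
  proof (cases ns)
    case (Cons x xs)
    show ?thesis
    proof (cases "N > 0")
      case True
      show ?thesis
        using sorted_wrt_Cons_head0[OF True, of xs] True Cons
        by (auto simp: index_lists_from_def index_lists_def simp del: sorted_wrt.simps)
    qed (use Cons in \<open>auto simp: index_lists_from_def index_lists_def\<close>)
  qed (auto simp: index_lists_from_def index_lists_def)
qed

lemma finite_index_lists_from: "finite (index_lists_from R l N)"
proof (induction l arbitrary: N)
  case 0
  have "index_lists_from R 0 N \<subseteq> {[]}" by (auto simp: index_lists_from_def index_lists_def)
  then show ?case by (rule finite_subset) simp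
qed (auto simp: index_lists_from_Suc fin)

lemma mz_coeff_eq_sum:
  "mz_coeff R s N = of_real (\<Sum>ns\<in>index_lists_from R (length s) N. index_weight s ns)"
proof (induction s arbitrary: N)
  case Nil
  have "index_lists_from R 0 N = (if N = 0 then {[]} else {})"
    by (auto simp: index_lists_from_def index_lists_def)
  then show ?case by (simp add: index_weight_def)
next
  case (Cons k s)
  show ?case
  proof (cases "N = 0")
    case False
    \<comment> \<open>The lists are grouped by the second index \<open>m\<close>. The groups are
      disjoint because \<open>m\<close> is \<open>head0\<close> of the tail.\<close>
    have "(\<Sum>ns\<in>index_lists_from R (length (k # s)) N. index_weight (k # s) ns)
        = (\<Sum>m | R N m. \<Sum>ns\<in>(#) N ` index_lists_from R (length s) m. index_weight (k # s) ns)"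
      using False
      by (subst sum.UNION_disjoint[symmetric])
         (auto simp: fin finite_index_lists_from index_lists_from_Suc, 
          auto simp: index_lists_from_def)
    also have "\<dots> = (\<Sum>m | R N m. \<Sum>ns\<in>index_lists_from R (length s) m. index_weight s ns) / real N ^ k"
      by (subst sum.reindex) (auto simp: index_weight_Cons sum_divide_distrib)
    finally show ?thesis
      using False by (simp add: Cons.IH)
  qed (simp add: index_lists_from_Suc)
qed

lemma mz_coeff_singleton: "mz_coeff R [k] N = (if N = 0 then 0 else 1 / of_nat N ^ k)"
  using bot[of N] by (simp add: of_bool_def sum.If_cases fin)

text \<open>Grouping the index lists by their first entry turns the unordered sum into the power
  series of \<open>f\<close>. Regrouping is legitimate because the weights are nonnegative: absolute
  convergence of the power series in the disc then carries over to the whole family.\<close>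

lemma infsum_index_lists:
  assumes "s \<noteq> []" and "norm z < 1"
    and holo: "f holomorphic_on ball 0 1" and expan: "f has_fps_expansion Abs_fps (mz_coeff R s)"
  shows "(\<Sum>\<^sub>\<infinity>ns\<in>index_lists R (length s). z ^ hd ns / (\<Prod>i<length s. of_nat (ns ! i) ^ (s ! i))) = f z"
proof -
  define T where "T = index_lists_from R (length s)"
  define g where "g = (\<lambda>(N, ns). z ^ N * of_real (index_weight s ns))"
  have "f holomorphic_on eball 0 1"
    using holo by (simp add: one_ereal_def)
  \<comment> \<open>Holomorphy of \<open>f\<close> on the disc bounds the radius of convergence from
    below, so no estimate of the coefficients is made.\<close>
  then have radius: "fps_conv_radius (Abs_fps (mz_coeff R s)) \<ge> 1"
    and sums: "(\<lambda>N. mz_coeff R s N * z ^ N) sums f z"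
    using holomorphic_on_imp_fps_conv_radius_ge[OF expan]
      has_fps_expansion_imp_sums_complex[OF expan, of 1 z] assms(2) by simp_all
  have "ereal (norm z) < fps_conv_radius (Abs_fps (mz_coeff R s))"
    using assms(2) by (intro less_le_trans[OF _ radius]) simp
  then have nsum: "summable (\<lambda>N. norm (mz_coeff R s N * z ^ N))"
    using norm_summable_fps[of z "Abs_fps (mz_coeff R s)"] by simp
  have inner: "((\<lambda>ns. g (N, ns)) has_sum mz_coeff R s N * z ^ N) (T N)" for N
    using has_sum_finite[OF finite_index_lists_from, of "\<lambda>ns. g (N, ns)" "length s" N]
    by (simp add: T_def g_def mz_coeff_eq_sum sum_distrib_left mult.commute)
  \<comment> \<open>All terms of a group are nonnegative multiples of the same \<open>z ^ N\<close>,
    so the norms add up without loss.\<close>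
  have norm_inner: "((\<lambda>ns. norm (g (N, ns))) has_sum norm (mz_coeff R s N * z ^ N)) (T N)" for N
  proof -
    have "(\<Sum>ns\<in>T N. norm (g (N, ns))) = norm (mz_coeff R s N * z ^ N)"
      unfolding mz_coeff_eq_sum T_def[symmetric] g_def
      by (simp add: norm_mult norm_power index_weight_nonneg sum_nonneg sum_distrib_left mult.commute
           flip: of_real_sum)
    then show ?thesis
      using has_sum_finite[OF finite_index_lists_from, of "\<lambda>ns. norm (g (N, ns))" "length s" N]
      by (simp add: T_def)
  qed
  have "(\<lambda>x. norm (g x)) summable_on Sigma UNIV T"
    using norm_inner norm_summable_imp_summable_on[of "\<lambda>N. norm (mz_coeff R s N * z ^ N)"] nsum
    by (intro summable_on_SigmaI) auto
  then have "g summable_on Sigma UNIV T"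
    by (rule abs_summable_summable)
  then have "(g has_sum f z) (Sigma UNIV T)"
    by (intro has_sum_SigmaI[OF inner] norm_summable_imp_has_sum[OF nsum] sums)
  also have "(g has_sum f z) (Sigma UNIV T) \<longleftrightarrow>
    ((\<lambda>ns. z ^ hd ns / (\<Prod>i<length s. of_nat (ns ! i) ^ (s ! i))) has_sum f z) (index_lists R (length s))"
  proof (rule has_sum_reindex_bij_witness[of _ "\<lambda>ns. (hd ns, ns)" snd])
    have hd: "head0 ns = hd ns" if "ns \<in> index_lists R (length s)" for ns
      using that assms(1) by (cases ns) (auto simp: index_lists_def)
    fix x assume "x \<in> Sigma UNIV T"
    then obtain N ns where x: "x = (N, ns)" "ns \<in> index_lists R (length s)" "N = hd ns"
      by (auto simp: T_def index_lists_from_def hd)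
    then show "z ^ hd (snd x) / (\<Prod>i<length s. of_nat (snd x ! i) ^ (s ! i)) = g x"
      by (simp add: g_def index_weight_def of_real_prod)
    show "(hd (snd x), snd x) = x" "snd x \<in> index_lists R (length s)" using x by auto
  next
    fix ns assume "ns \<in> index_lists R (length s)"
    moreover from this have "head0 ns = hd ns"
      using assms(1) by (cases ns) (auto simp: index_lists_def)
    ultimately show "(hd ns, ns) \<in> Sigma UNIV T" by (auto simp: T_def index_lists_from_def)
  qed simp_all
  finally show ?thesis
    by (rule infsumI)
qed

end

interpretation gt: index_order "(>)"
  by standard (auto simp: transp_def)

interpretation ge: index_order "(\<ge>)"
  by standard (auto simp: transp_def)

lemma Li_series_eq:
  assumes "s \<noteq> []" "f holomorphic_on ball 0 1" "f has_fps_expansion Abs_fps (mz_coeff (>) s)" "norm z < 1"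
  shows "Li_series s z = f z"
  using gt.infsum_index_lists[OF assms(1,4,2,3)] by (simp add: Li_series_def index_lists_def)

lemma Le_series_eq:
  assumes "s \<noteq> []" "f holomorphic_on ball 0 1" "f has_fps_expansion Abs_fps (mz_coeff (\<ge>) s)" "norm z < 1"
  shows "Le_series s z = f z"
  using ge.infsum_index_lists[OF assms(1,4,2,3)] by (simp add: Le_series_def index_lists_def)

section \<open>Geometry of the slit plane\<close>

lemma starlike_slit_plane: "starlike slit_plane"
  unfolding starlike_def
proof (intro bexI ballI subsetI)
  show "0 \<in> slit_plane" by (auto simp: slit_plane_def)
  fix x y assume x: "x \<in> slit_plane" and y: "y \<in> closed_segment 0 x"
  from y obtain u where u: "0 \<le> u" "u \<le> 1" "y = of_real u * x"
    by (auto simp: closed_segment_def scaleR_conv_of_real)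
  show "y \<in> slit_plane"
    unfolding slit_plane_def
  proof (rule ComplI)
    assume "y \<in> complex_of_real ` {1..}"
    then obtain t where t: "t \<ge> 1" "y = of_real t" by auto
    with u have "u > 0" by (cases "u = 0") auto
    with t u have "x = of_real (t / u)" "t / u \<ge> 1" by (auto simp: field_simps)
    with x show False unfolding slit_plane_def by blast
  qed
qed

lemma zero_in_slit_plane: "0 \<in> slit_plane"
  by (auto simp: slit_plane_def)

lemma not_one_slit_plane: "z \<in> slit_plane \<Longrightarrow> z \<noteq> 1"
  by (force simp: slit_plane_def)

text \<open>The map is its own inverse and sends real t > 1 to t / (t - 1) > 1. A value on the cut
  would therefore force \<open>z\<close> onto the cut; the value 1 is never attained.\<close>

lemma moebius_slit_plane:
  assumes "z \<in> slit_plane"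
  shows "z / (z - 1) \<in> slit_plane"
  unfolding slit_plane_def
proof (rule ComplI)
  assume "z / (z - 1) \<in> complex_of_real ` {1..}"
  then obtain t where t: "t \<ge> 1" "z / (z - 1) = of_real t" by auto
  have "z \<noteq> 1" using not_one_slit_plane assms by blast
  then have eq: "z * (of_real t - 1) = of_real t" using t by (simp add: field_simps)
  then have "t \<noteq> 1" by auto
  then have "z = of_real (t / (t - 1))" using eq by (simp add: field_simps)
  moreover have "t / (t - 1) \<ge> 1" using t(1) \<open>t \<noteq> 1\<close> by (simp add: field_simps)
  ultimately show False using assms unfolding slit_plane_def by blast
qed

lemma has_field_derivative_moebius:
  fixes z :: complex
  assumes "z \<noteq> 1"
  shows "((\<lambda>z. z / (z - 1)) has_field_derivative - 1 / (1 - z) ^ 2) (at z)"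
  using assms by (auto intro!: derivative_eq_intros simp: field_simps power2_eq_square)

section \<open>Functions on the slit plane and their expansions at 0\<close>

text \<open>A global function is paired with its germ at 0. On the connected slit plane each
  determines the other, so identities can be proved for functions or for coefficients, whichever is
  easier.\<close>

definition slit_expansion :: "(complex \<Rightarrow> complex) \<Rightarrow> complex fps \<Rightarrow> bool" where
  "slit_expansion f F \<longleftrightarrow> f holomorphic_on slit_plane \<and> f has_fps_expansion F"

named_theorems slit_intros

lemma slit_expansion_const [slit_intros]: "slit_expansion (\<lambda>_. c) (fps_const c)"
  by (simp add: slit_expansion_def)

lemma slit_expansion_one [slit_intros]: "slit_expansion (\<lambda>_. 1) 1"
  by (simp add: slit_expansion_def)

lemma slit_expansion_X [slit_intros]: "slit_expansion (\<lambda>z. z) fps_X"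
  by (simp add: slit_expansion_def has_fps_expansion_fps_X)

lemma slit_expansion_diff [slit_intros]:
  "slit_expansion f F \<Longrightarrow> slit_expansion g G \<Longrightarrow> slit_expansion (\<lambda>z. f z - g z) (F - G)"
  by (simp add: slit_expansion_def has_fps_expansion_diff holomorphic_on_diff)

lemma slit_expansion_mult [slit_intros]:
  "slit_expansion f F \<Longrightarrow> slit_expansion g G \<Longrightarrow> slit_expansion (\<lambda>z. f z * g z) (F * G)"
  by (simp add: slit_expansion_def has_fps_expansion_mult holomorphic_on_mult)

lemma slit_expansion_sum [slit_intros]:
  "(\<And>x. x \<in> A \<Longrightarrow> slit_expansion (f x) (F x)) \<Longrightarrow>
    slit_expansion (\<lambda>z. \<Sum>x\<in>A. f x z) (\<Sum>x\<in>A. F x)"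
  by (simp add: slit_expansion_def has_fps_expansion_sum holomorphic_on_sum)

lemma slit_expansion_deriv [slit_intros]:
  "slit_expansion f F \<Longrightarrow> slit_expansion (deriv f) (fps_deriv F)"
  by (simp add: slit_expansion_def has_fps_expansion_deriv holomorphic_deriv open_slit_plane)

lemma slit_expansion_geometric [slit_intros]: "slit_expansion (\<lambda>z. 1 / (1 - z)) (Abs_fps (\<lambda>_. 1))"
proof -
  have "(\<lambda>z. inverse (1 - z)) has_fps_expansion inverse (1 - fps_X :: complex fps)"
    by (intro fps_expansion_intros) simp
  moreover have "inverse (1 - fps_X :: complex fps) = Abs_fps (\<lambda>_. 1)"
    using fps_inverse_idempotent[of "Abs_fps (\<lambda>_. 1) :: complex fps"] by (simp add: fps_inverse_gp')
  ultimately show ?thesis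
    using not_one_slit_plane
    by (auto simp: slit_expansion_def inverse_eq_divide intro!: holomorphic_intros)
qed

lemma slit_expansion_at_0: "slit_expansion f F \<Longrightarrow> f 0 = F $ 0"
  by (simp add: slit_expansion_def has_fps_expansion_imp_0_eq_fps_nth_0)

lemma slit_expansion_unique_fun:
  assumes "slit_expansion f F" "slit_expansion g F" "z \<in> slit_plane"
  shows "f z = g z"
  using has_fps_expansion_0_analytic_continuation[of "\<lambda>z. f z - g z" slit_plane z]
    slit_expansion_diff[OF assms(1,2)] assms(3)
    open_slit_plane connected_slit_plane zero_in_slit_plane
  by (simp add: slit_expansion_def)

text \<open>Both conditions depend only on values in the slit plane. This carries expansions over to
  \<open>Li s\<close> and \<open>Le s\<close>, whose values are known only there.\<close>

lemma slit_expansion_cong: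
  assumes "slit_expansion f F" "\<And>z. z \<in> slit_plane \<Longrightarrow> g z = f z"
  shows "slit_expansion g F"
proof -
  have "eventually (\<lambda>z. g z = f z) (nhds 0)"
    using eventually_nhds_in_open[OF open_slit_plane zero_in_slit_plane]
    by eventually_elim (rule assms(2))
  then show ?thesis
    using assms has_fps_expansion_cong[of g f F F] holomorphic_cong[of slit_plane slit_plane g f]
    by (simp add: slit_expansion_def)
qed

lemma slit_expansion_unique_fps:
  assumes "slit_expansion f F" "slit_expansion g G" "\<And>z. z \<in> slit_plane \<Longrightarrow> f z = g z"
  shows "F = G"
  using assms(1) slit_expansion_cong[OF assms(2,3)]
  by (metis fps_expansion_eqI slit_expansion_def)

section \<open>Inverting the Euler operator\<close>

text \<open>The inverse of the Euler operator \<open>z d/dz\<close>; the constant term \<open>F $ 0 / 0\<close> is \<open>0\<close>.\<close>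

definition euler_integral :: "complex fps \<Rightarrow> complex fps" where
  "euler_integral F = Abs_fps (\<lambda>n. F $ n / of_nat n)"

lemma euler_integral_funpow_nth: "(euler_integral ^^ k) F $ n = F $ n / of_nat n ^ k"
  by (induction k) (simp_all add: euler_integral_def)

text \<open>Comparing coefficients in the differential equation gives n times the n-th coefficient
  of \<open>g\<close> for n > 0; the constant term is fixed by \<open>g 0 = 0\<close>.\<close>

lemma slit_expansion_euler_integralI:
  assumes f: "slit_expansion f F" and g: "g holomorphic_on slit_plane" "g 0 = 0"
    and deriv: "\<And>z. z \<in> slit_plane \<Longrightarrow> z * deriv g z = f z - f 0"
  shows "slit_expansion g (euler_integral F)"
proof -
  have "g analytic_on {0}"
    using g(1) open_slit_plane zero_in_slit_plane analytic_at by blast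
  then have G: "slit_expansion g (fps_expansion g 0)"
    using g(1) analytic_at_imp_has_fps_expansion_0 by (simp add: slit_expansion_def)
  define G where "G = fps_expansion g 0"
  have "fps_X * fps_deriv G = F - fps_const (F $ 0)"
    by (rule slit_expansion_unique_fps[where f = "\<lambda>z. z * deriv g z" and g = "\<lambda>z. f z - f 0"])
       (use f G deriv slit_expansion_at_0[OF f] in \<open>auto simp: G_def intro!: slit_intros\<close>)
  then have nth: "(fps_X * fps_deriv G) $ n = (F - fps_const (F $ 0)) $ n" for n by simp
  have "G $ n = F $ n / of_nat n" for n
  proof (cases n)
    case 0
    then show ?thesis using slit_expansion_at_0[OF G] g(2) by (simp add: G_def)
  next
    case (Suc m)
    then show ?thesis using nth[of n] by (simp add: field_simps del: of_nat_Suc)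
  qed
  then have "G = euler_integral F" by (simp add: euler_integral_def fps_eq_iff)
  with G show ?thesis by (simp add: G_def)
qed

lemma slit_expansion_euler_integral:
  assumes f: "slit_expansion f F"
  shows "\<exists>g. slit_expansion g (euler_integral F)"
proof -
  \<comment> \<open>The quotient (f z - f 0) / z with its removable singularity at 0 filled in. Its
    primitive, which exists because the slit plane is starlike, solves the Euler equation once it is
    normalised at 0.\<close>
  define h where "h = (\<lambda>z. if z = 0 then deriv f 0 else (f z - f 0) / (z - 0))"
  have "f holomorphic_on slit_plane" using f by (simp add: slit_expansion_def)
  then have h: "h holomorphic_on slit_plane"
    unfolding h_def by (rule pole_lemma_open) (rule open_slit_plane)
  obtain g where g: "(g has_field_derivative h z) (at z)" if "z \<in> slit_plane" for z
    using holomorphic_starlike_primitive[OF _ starlike_slit_plane open_slit_plane finite.emptyI, of h]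
      h holomorphic_on_imp_continuous_on holomorphic_on_imp_differentiable_at open_slit_plane
    by (metis Diff_empty)
  have der: "((\<lambda>z. g z - g 0) has_field_derivative h z) (at z)" if "z \<in> slit_plane" for z
    using g[OF that] by (auto intro!: derivative_eq_intros)
  have "slit_expansion (\<lambda>z. g z - g 0) (euler_integral F)"
  proof (rule slit_expansion_euler_integralI[OF f])
    show "(\<lambda>z. g z - g 0) holomorphic_on slit_plane"
      using der open_slit_plane holomorphic_on_open by blast
    fix z assume "z \<in> slit_plane"
    then show "z * deriv (\<lambda>z. g z - g 0) z = f z - f 0"
      by (simp add: DERIV_imp_deriv[OF der] h_def)
  qed simp
  then show ?thesis by blast
qed

section \<open>Existence of the continuations\<close>

text \<open>Multiplying by the geometric series forms partial sums over m \<le> n, and the factor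
  \<open>fps_X\<close> shifts them to the strict range m < n.\<close>

lemma mz_coeff_gt_Cons:
  "Abs_fps (mz_coeff (>) (k # s)) =
     (euler_integral ^^ k) (fps_X * Abs_fps (\<lambda>_. 1) * Abs_fps (mz_coeff (>) s))"
proof -
  have "(Abs_fps (\<lambda>_. 1) * Abs_fps (mz_coeff (>) s)) $ n = (\<Sum>m\<le>n. mz_coeff (>) s m)" for n
    by (subst mult.commute) (simp add: fps_mult_nth atMost_atLeast0)
  moreover have "{m. m < Suc n} = {..n}" for n by auto
  ultimately show ?thesis
    by (auto simp: fps_eq_iff euler_integral_funpow_nth mult.assoc gr0_conv_Suc split: nat.split)
qed

text \<open>Here the range m \<le> n needs no shift, but the coefficient at 0 has to vanish. It is
  subtracted explicitly because dividing by \<open>of_nat n ^ k\<close> does not remove it when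
  \<open>k = 0\<close>.\<close>

lemma mz_coeff_ge_Cons:
  defines "G \<equiv> \<lambda>s. Abs_fps (\<lambda>_. 1) * Abs_fps (mz_coeff (\<ge>) s)"
  shows "Abs_fps (mz_coeff (\<ge>) (k # s)) = (euler_integral ^^ k) (G s - fps_const (G s $ 0))"
proof -
  have "G s $ n = (\<Sum>m\<le>n. mz_coeff (\<ge>) s m)" for n
    unfolding G_def by (subst mult.commute) (simp add: fps_mult_nth atMost_atLeast0)
  moreover have "{m. m \<le> n} = {..n}" for n :: nat by auto
  ultimately show ?thesis
    by (auto simp: fps_eq_iff euler_integral_funpow_nth)
qed

lemma ex_slit_expansion_funpow:
  assumes "slit_expansion f F"
  shows "\<exists>g. slit_expansion g ((euler_integral ^^ k) F)"
  by (induction k) (use assms slit_expansion_euler_integral in auto)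

lemma ex_slit_expansion_gt: "\<exists>f. slit_expansion f (Abs_fps (mz_coeff (>) s))"
proof (induction s)
  case Nil
  have "Abs_fps (mz_coeff (>) []) = 1" by (simp add: fps_eq_iff)
  then show ?case using slit_expansion_one by metis
next
  case (Cons k s)
  then obtain f where f: "slit_expansion f (Abs_fps (mz_coeff (>) s))" by blast
  show ?case
    unfolding mz_coeff_gt_Cons
    by (rule ex_slit_expansion_funpow slit_expansion_mult slit_expansion_X slit_expansion_geometric f)+
qed

lemma ex_slit_expansion_ge: "\<exists>f. slit_expansion f (Abs_fps (mz_coeff (\<ge>) s))"
proof (induction s)
  case Nil
  have "Abs_fps (mz_coeff (\<ge>) []) = 1" by (simp add: fps_eq_iff)
  then show ?case using slit_expansion_one by metis
next
  case (Cons k s)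
  then obtain f where f: "slit_expansion f (Abs_fps (mz_coeff (\<ge>) s))" by blast
  show ?case
    unfolding mz_coeff_ge_Cons
    by (rule ex_slit_expansion_funpow slit_expansion_diff slit_expansion_const
          slit_expansion_mult slit_expansion_geometric f)+
qed

text \<open>On the disc \<open>f\<close> agrees with the sum over index lists, so it is a
  continuation, and the uniqueness in \<open>slit_continuation_eq\<close> identifies its
  values.\<close>

lemma Li_eqI:
  assumes "s \<noteq> []" "slit_expansion f (Abs_fps (mz_coeff (>) s))" "z \<in> slit_plane"
  shows "Li s z = f z"
  unfolding Li_def
proof (rule slit_continuation_eq[OF _ _ assms(3)])
  show f: "f holomorphic_on slit_plane" using assms(2) by (simp add: slit_expansion_def)
  show "f u = Li_series s u" if "u \<in> ball 0 1" for u
    using Li_series_eq[OF assms(1) holomorphic_on_subset[OF f ball_subset_slit_plane]] assms(2) that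
    by (simp add: slit_expansion_def)
qed

lemma Le_eqI:
  assumes "s \<noteq> []" "slit_expansion f (Abs_fps (mz_coeff (\<ge>) s))" "z \<in> slit_plane"
  shows "Le s z = f z"
  unfolding Le_def
proof (rule slit_continuation_eq[OF _ _ assms(3)])
  show f: "f holomorphic_on slit_plane" using assms(2) by (simp add: slit_expansion_def)
  show "f u = Le_series s u" if "u \<in> ball 0 1" for u
    using Le_series_eq[OF assms(1) holomorphic_on_subset[OF f ball_subset_slit_plane]] assms(2) that
    by (simp add: slit_expansion_def)
qed

lemma slit_expansion_Li: "s \<noteq> [] \<Longrightarrow> slit_expansion (Li s) (Abs_fps (mz_coeff (>) s))"
  using ex_slit_expansion_gt[of s] Li_eqI[of s] slit_expansion_cong by blast

lemma slit_expansion_Le: "s \<noteq> [] \<Longrightarrow> slit_expansion (Le s) (Abs_fps (mz_coeff (\<ge>) s))"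
  using ex_slit_expansion_ge[of s] Le_eqI[of s] slit_expansion_cong by blast

section \<open>Sums over compositions\<close>

lemma mz_coeff_one_Cons: "mz_coeff R (1 # s) N = (\<Sum>m | R N m. mz_coeff R s m) / of_nat N"
  by simp

lemma mz_coeff_Suc_hd:
  "p \<noteq> [] \<Longrightarrow> mz_coeff R (Suc (hd p) # tl p) N = mz_coeff R p N / of_nat N"
  by (cases p) simp_all

lemma compositions_1: "compositions (Suc 0) = {[1]}"
proof -
  have "p = [1]" if "p \<in> compositions (Suc 0)" for p
  proof (cases p)
    case (Cons k q)
    then have "q = []" using that by (cases q) (auto simp: compositions_def)
    with Cons that show ?thesis by (auto simp: compositions_def)
  qed (use that in \<open>simp add: compositions_def\<close>)
  then show ?thesis by (auto simp: compositions_def)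
qed

lemma compositions_Suc:
  assumes "n > 0"
  shows "compositions (Suc n) = (#) 1 ` compositions n \<union> (\<lambda>p. Suc (hd p) # tl p) ` compositions n"
proof (intro set_eqI iffI)
  fix p assume p: "p \<in> compositions (Suc n)"
  then obtain k q where kq: "p = k # q" by (cases p) (auto simp: compositions_def)
  show "p \<in> (#) 1 ` compositions n \<union> (\<lambda>p. Suc (hd p) # tl p) ` compositions n"
  proof (cases "k = 1")
    case True
    then have "q \<in> compositions n" using p kq assms by (auto simp: compositions_def)
    then show ?thesis using True kq by blast
  next
    case False
    then have "(k - 1) # q \<in> compositions n" "p = Suc (hd ((k - 1) # q)) # tl ((k - 1) # q)"
      using p kq by (auto simp: compositions_def)
    then show ?thesis by blast
  qed
next
  fix p assume "p \<in> (#) 1 ` compositions n \<union> (\<lambda>p. Suc (hd p) # tl p) ` compositions n"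
  then obtain q where "q \<in> compositions n" "p = 1 # q \<or> p = Suc (hd q) # tl q" by blast
  then show "p \<in> compositions (Suc n)" by (cases q) (auto simp: compositions_def)
qed

lemma finite_compositions: "n > 0 \<Longrightarrow> finite (compositions n)"
  by (induction n rule: nat_induct_non_zero) (auto simp: compositions_1 compositions_Suc)

lemma sum_compositions_Suc:
  assumes "n > 0"
  shows "(\<Sum>p\<in>compositions (Suc n). h p) =
    (\<Sum>p\<in>compositions n. h (1 # p)) + (\<Sum>p\<in>compositions n. h (Suc (hd p) # tl p))"
proof -
  have ne: "p \<noteq> [] \<and> hd p > 0" if "p \<in> compositions n" for p
    using that by (auto simp: compositions_def)
  have "inj_on (\<lambda>p. Suc (hd p) # tl p) (compositions n)"
    by (rule inj_onI) (use ne in \<open>auto intro: list.expand\<close>)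
  \<comment> \<open>Parts are positive, so an increased first part is at least 2 and never equals a
    new 1.\<close>
  moreover have "(#) 1 ` compositions n \<inter> (\<lambda>p. Suc (hd p) # tl p) ` compositions n = {}"
    using ne by fastforce
  ultimately show ?thesis
    using assms by (simp add: compositions_Suc sum.union_disjoint finite_compositions sum.reindex)
qed

text \<open>Ensures that the natural subtraction \<open>n - length p\<close> in the sign is never
  truncated.\<close>

lemma length_le_composition:
  assumes "p \<in> compositions n"
  shows "length p \<le> n"
proof -
  have "(\<forall>x\<in>set p. x > 0) \<longrightarrow> length p \<le> sum_list p"
    by (induction p) auto
  with assms show ?thesis by (auto simp: compositions_def)
qed

text \<open>In the inner sum over m \<le> N, the terms m < N yield compositions with a new first
  part 1. The term m = N only contributes another factor 1 / N, which increases the first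
  part.\<close>

lemma mz_coeff_ge_ones:
  assumes "n > 0"
  shows "mz_coeff (\<ge>) (replicate n 1) N = (\<Sum>p\<in>compositions n. mz_coeff (>) p N)"
  using assms
proof (induction n arbitrary: N rule: nat_induct_non_zero)
  case 1
  show ?case
    by (simp add: compositions_1 gt.mz_coeff_singleton ge.mz_coeff_singleton del: mz_coeff.simps)
next
  case (Suc n)
  let ?S = "\<lambda>N. \<Sum>p\<in>compositions n. mz_coeff (>) p N"
  have "{m. m \<le> N} = insert N {m. m < N}" by auto
  then have "mz_coeff (\<ge>) (replicate (Suc n) 1) N = (\<Sum>m | m < N. ?S m) / of_nat N + ?S N / of_nat N"
    unfolding replicate_Suc mz_coeff_one_Cons Suc.IH by (simp add: add_divide_distrib)
  also have "(\<Sum>m | m < N. ?S m) / of_nat N = (\<Sum>p\<in>compositions n. mz_coeff (>) (1 # p) N)"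
    unfolding mz_coeff_one_Cons by (subst sum.swap) (simp add: sum_divide_distrib)
  also have "?S N / of_nat N = (\<Sum>p\<in>compositions n. mz_coeff (>) (Suc (hd p) # tl p) N)"
    unfolding sum_divide_distrib by (intro sum.cong refl mz_coeff_Suc_hd[symmetric]) (simp add: compositions_def)
  finally show ?case using Suc.hyps by (simp add: sum_compositions_Suc)
qed

text \<open>The dual argument: the sum over m < N is the sum over m \<le> N minus the term m = N.
  Each increase of a part thus changes the sign, and \<open>n - length p\<close> counts the
  increases.\<close>

lemma mz_coeff_gt_ones:
  assumes "n > 0"
  shows "mz_coeff (>) (replicate n 1) N =
    (\<Sum>p\<in>compositions n. (-1) ^ (n - length p) * mz_coeff (\<ge>) p N)"
  using assms
proof (induction n arbitrary: N rule: nat_induct_non_zero)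
  case 1
  show ?case
    by (simp add: compositions_1 gt.mz_coeff_singleton ge.mz_coeff_singleton del: mz_coeff.simps)
next
  case (Suc n)
  let ?c = "\<lambda>p. (-1) ^ (n - length p) :: complex"
  let ?S = "\<lambda>N. \<Sum>p\<in>compositions n. ?c p * mz_coeff (\<ge>) p N"
  have "{m. m \<le> N} = insert N {m. m < N}" by auto
  then have "mz_coeff (>) (replicate (Suc n) 1) N = (\<Sum>m | m \<le> N. ?S m) / of_nat N - ?S N / of_nat N"
    unfolding replicate_Suc mz_coeff_one_Cons Suc.IH by (simp add: diff_divide_distrib[symmetric])
  also have "(\<Sum>m | m \<le> N. ?S m) / of_nat N = (\<Sum>p\<in>compositions n. ?c p * mz_coeff (\<ge>) (1 # p) N)"
    unfolding mz_coeff_one_Cons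
    by (subst sum.swap) (simp add: sum_divide_distrib sum_distrib_left)
  also have "\<dots> = (\<Sum>p\<in>compositions n. (-1) ^ (Suc n - length (1 # p)) * mz_coeff (\<ge>) (1 # p) N)"
    by simp
  also have "?S N / of_nat N = - (\<Sum>p\<in>compositions n.
      (-1) ^ (Suc n - length (Suc (hd p) # tl p)) * mz_coeff (\<ge>) (Suc (hd p) # tl p) N)"
    unfolding sum_divide_distrib sum_negf[symmetric]
  proof (intro sum.cong refl)
    fix p assume p: "p \<in> compositions n"
    then have "p \<noteq> []" by (simp add: compositions_def)
    moreover from this have "length (Suc (hd p) # tl p) = length p" by simp
    ultimately show "?c p * mz_coeff (\<ge>) p N / of_nat N =
        - ((-1) ^ (Suc n - length (Suc (hd p) # tl p)) * mz_coeff (\<ge>) (Suc (hd p) # tl p) N)"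
      using length_le_composition[OF p] by (simp add: mz_coeff_Suc_hd Suc_diff_le del: mz_coeff.simps)
  qed
  finally show ?case using Suc.hyps by (simp add: sum_compositions_Suc)
qed

section \<open>Passing from coefficients to continuations\<close>

lemma Le_ones_eq_sum:
  assumes "n > 0" "z \<in> slit_plane"
  shows "Le (replicate n 1) z = (\<Sum>p\<in>compositions n. Li p z)"
proof (rule Le_eqI[OF _ _ assms(2)])
  have "slit_expansion (\<lambda>z. \<Sum>p\<in>compositions n. Li p z)
          (\<Sum>p\<in>compositions n. Abs_fps (mz_coeff (>) p))"
    by (intro slit_intros slit_expansion_Li) (simp add: compositions_def)
  also have "(\<Sum>p\<in>compositions n. Abs_fps (mz_coeff (>) p)) = Abs_fps (mz_coeff (\<ge>) (replicate n 1))"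
    using mz_coeff_ge_ones[OF assms(1)] by (simp add: fps_eq_iff fps_sum_nth)
  finally show "slit_expansion (\<lambda>z. \<Sum>p\<in>compositions n. Li p z) \<dots>" .
qed (use assms in simp)

lemma Li_ones_eq_sum:
  assumes "n > 0" "z \<in> slit_plane"
  shows "Li (replicate n 1) z = (\<Sum>p\<in>compositions n. (-1) ^ (n - length p) * Le p z)"
proof (rule Li_eqI[OF _ _ assms(2)])
  have "slit_expansion (\<lambda>z. \<Sum>p\<in>compositions n. (-1) ^ (n - length p) * Le p z)
          (\<Sum>p\<in>compositions n. fps_const ((-1) ^ (n - length p)) * Abs_fps (mz_coeff (\<ge>) p))"
    by (intro slit_intros slit_expansion_Le) (simp add: compositions_def)
  also have "(\<Sum>p\<in>compositions n. fps_const ((-1) ^ (n - length p)) * Abs_fps (mz_coeff (\<ge>) p))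
      = Abs_fps (mz_coeff (>) (replicate n 1))"
    using mz_coeff_gt_ones[OF assms(1)] by (simp add: fps_eq_iff fps_sum_nth)
  finally show "slit_expansion (\<lambda>z. \<Sum>p\<in>compositions n. (-1) ^ (n - length p) * Le p z) \<dots>" .
qed (use assms in simp)

section \<open>Closed forms for vectors of ones\<close>

text \<open>Exponent 0 gives a geometric series, where the chain of Euler derivatives in
  \<open>deriv_Li_singleton\<close> ends.\<close>

lemma Li_0_eq:
  assumes "z \<in> slit_plane"
  shows "Li [0] z = z / (1 - z)"
proof (rule Li_eqI[OF _ _ assms])
  have "slit_expansion (\<lambda>z. z * (1 / (1 - z))) (fps_X * Abs_fps (\<lambda>_. 1))"
    by (intro slit_intros)
  moreover have "fps_X * Abs_fps (\<lambda>_. 1) = Abs_fps (mz_coeff (>) [0])"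
    by (simp add: fps_eq_iff gt.mz_coeff_singleton del: mz_coeff.simps)
  ultimately show "slit_expansion (\<lambda>z. z / (1 - z)) (Abs_fps (mz_coeff (>) [0]))" by simp
qed simp

lemma deriv_Li_singleton:
  assumes "z \<in> slit_plane"
  shows "z * deriv (Li [Suc k]) z = Li [k] z"
proof (rule Li_eqI[symmetric, OF _ _ assms])
  have "slit_expansion (\<lambda>z. z * deriv (Li [Suc k]) z) (fps_X * fps_deriv (Abs_fps (mz_coeff (>) [Suc k])))"
    by (intro slit_intros slit_expansion_Li) simp
  also have "fps_X * fps_deriv (Abs_fps (mz_coeff (>) [Suc k])) = Abs_fps (mz_coeff (>) [k])"
    by (auto simp: fps_eq_iff gt.mz_coeff_singleton gr0_conv_Suc field_simps
        simp del: mz_coeff.simps of_nat_Suc)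
  finally show "slit_expansion (\<lambda>z. z * deriv (Li [Suc k]) z) \<dots>" .
qed simp

text \<open>With w = z / (z - 1) the chain rule gives z dw/dz = w / (1 - z). So z d/dz becomes w
  d/dw divided by 1 - z, and w d/dw lowers the exponent of \<open>Li\<close>.\<close>

lemma Li_moebius:
  shows "(\<lambda>z. - Li [k] (z / (z - 1))) holomorphic_on slit_plane"
    and "\<And>z. z \<in> slit_plane \<Longrightarrow>
      z * deriv (\<lambda>z. - Li [Suc k] (z / (z - 1))) z = - Li [k] (z / (z - 1)) * (1 / (1 - z))"
proof -
  have holo: "Li [k] holomorphic_on slit_plane" for k
    using slit_expansion_Li[of "[k]"] by (simp add: slit_expansion_def)
  have "(\<lambda>z. z / (z - 1)) holomorphic_on slit_plane"
    using not_one_slit_plane by (auto intro!: holomorphic_intros)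
  from holomorphic_on_compose_gen[OF this holo, of k] moebius_slit_plane
  show "(\<lambda>z. - Li [k] (z / (z - 1))) holomorphic_on slit_plane"
    by (auto simp: o_def intro!: holomorphic_intros)
  fix z assume z: "z \<in> slit_plane"
  define w where "w = z / (z - 1)"
  have z1: "z \<noteq> 1" and w: "w \<in> slit_plane"
    using not_one_slit_plane moebius_slit_plane z by (auto simp: w_def)
  define D where "D = deriv (Li [Suc k]) w"
  have "(Li [Suc k] has_field_derivative D) (at w)"
    unfolding D_def by (rule holomorphic_derivI[OF holo open_slit_plane w])
  then have "((\<lambda>z. - Li [Suc k] (z / (z - 1))) has_field_derivative - (D * (- 1 / (1 - z) ^ 2))) (at z)"
    unfolding w_def by (intro DERIV_minus DERIV_chain2 has_field_derivative_moebius z1)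
  then have "z * deriv (\<lambda>z. - Li [Suc k] (z / (z - 1))) z = z * (D / (1 - z) ^ 2)"
    by (simp add: DERIV_imp_deriv)
  also have "\<dots> = - (w * D) * (1 / (1 - z))"
  proof -
    have "w = - (z / (1 - z))" using z1 by (simp add: w_def divide_simps algebra_simps)
    then show ?thesis by (simp add: power2_eq_square)
  qed
  finally show "z * deriv (\<lambda>z. - Li [Suc k] (z / (z - 1))) z = - Li [k] (z / (z - 1)) * (1 / (1 - z))"
    by (simp only: deriv_Li_singleton[OF w, of k, folded D_def] flip: w_def)
qed

lemma Li_singleton_0: "Li [Suc k] 0 = 0"
  using slit_expansion_at_0[OF slit_expansion_Li[of "[Suc k]"]] by simp

text \<open>Prepending a 1 multiplies by 1 / (1 - z) and inverts the Euler operator. By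
  \<open>Li_moebius\<close> the claimed closed form obeys the same recursion.\<close>

lemma slit_expansion_ge_ones:
  "slit_expansion (\<lambda>z. - Li [Suc n] (z / (z - 1))) (Abs_fps (mz_coeff (\<ge>) (replicate (Suc n) 1)))"
proof (induction n)
  case 0
  have "Abs_fps (mz_coeff (\<ge>) []) = 1" by (simp add: fps_eq_iff)
  then have eq: "Abs_fps (mz_coeff (\<ge>) (replicate (Suc 0) 1))
      = euler_integral (Abs_fps (\<lambda>_. 1) - fps_const 1)"
    using mz_coeff_ge_Cons[of 1 "[]"] by simp
  show ?case
    unfolding eq
  proof (rule slit_expansion_euler_integralI)
    show "slit_expansion (\<lambda>z. 1 / (1 - z) - 1) (Abs_fps (\<lambda>_. 1) - fps_const 1)"
      by (intro slit_intros)
    fix z assume z: "z \<in> slit_plane"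
    then have "z \<noteq> 1" by (rule not_one_slit_plane)
    then have "1 - z / (z - 1) = - 1 / (z - 1)" by (simp add: field_simps)
    \<comment> \<open>At exponent 0 the closed form is \<open>z\<close>, and z / (1 - z) is the
      geometric series without its constant term.\<close>
    then have "Li [0] (z / (z - 1)) = - z"
      using Li_0_eq[OF moebius_slit_plane[OF z]] \<open>z \<noteq> 1\<close> by simp
    then show "z * deriv (\<lambda>z. - Li [Suc 0] (z / (z - 1))) z = 1 / (1 - z) - 1 - (1 / (1 - 0) - 1)"
      using Li_moebius(2)[OF z, of 0] \<open>z \<noteq> 1\<close> by (simp add: divide_simps)
  qed (simp_all add: Li_moebius(1) Li_singleton_0)
next
  case (Suc n)
  define G where "G = Abs_fps (\<lambda>_. 1) * Abs_fps (mz_coeff (\<ge>) (replicate (Suc n) 1))"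
  have eq: "Abs_fps (mz_coeff (\<ge>) (replicate (Suc (Suc n)) 1)) = euler_integral (G - fps_const (G $ 0))"
    using mz_coeff_ge_Cons[of 1 "replicate (Suc n) 1"] by (simp add: G_def)
  show ?case
    unfolding eq
  proof (rule slit_expansion_euler_integralI)
    show "slit_expansion (\<lambda>z. 1 / (1 - z) * - Li [Suc n] (z / (z - 1)) - G $ 0) (G - fps_const (G $ 0))"
      unfolding G_def by (intro slit_intros Suc)
  qed (use Li_moebius(2)[of _ "Suc n"] in \<open>simp_all add: Li_moebius(1) Li_singleton_0 mult.commute\<close>)
qed

lemma Le_ones_eq_Li:
  assumes "n > 0" "z \<in> slit_plane"
  shows "Le (replicate n 1) z = - Li [n] (z / (z - 1))"
  using assms slit_expansion_ge_ones[of "n - 1"] by (intro Le_eqI) simp_all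

text \<open>Keeps \<open>1 - z\<close> off the branch cut of \<open>Ln\<close>.\<close>

lemma slit_plane_one_minus: "z \<in> slit_plane \<Longrightarrow> 1 - z \<notin> \<real>\<^sub>\<le>\<^sub>0"
proof
  assume z: "z \<in> slit_plane" "1 - z \<in> \<real>\<^sub>\<le>\<^sub>0"
  then obtain r where "1 - z = of_real r" "r \<le> 0" by (auto elim: nonpos_Reals_cases)
  then have "z = of_real (1 - r)" "1 - r \<ge> 1" by (auto simp: algebra_simps)
  with z show False unfolding slit_plane_def by blast
qed

text \<open>Since - Ln (1 - z) has derivative 1 / (1 - z), the Euler operator takes the n+1st
  divided power to z / (1 - z) times the n-th, which is the recursion for prepending a 1 in
  \<open>Li\<close>.\<close>

lemma slit_expansion_gt_ones:
  "slit_expansion (\<lambda>z. (- Ln (1 - z)) ^ n / fact n) (Abs_fps (mz_coeff (>) (replicate n 1)))"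
proof (induction n)
  case 0
  have "Abs_fps (\<lambda>n. of_bool (n = 0)) = (1 :: complex fps)" by (simp add: fps_eq_iff)
  then show ?case using slit_expansion_one by simp
next
  case (Suc n)
  let ?f = "\<lambda>n z. (- Ln (1 - z)) ^ n / fact n :: complex"
  have eq: "Abs_fps (mz_coeff (>) (replicate (Suc n) 1))
      = euler_integral (fps_X * Abs_fps (\<lambda>_. 1) * Abs_fps (mz_coeff (>) (replicate n 1)))"
    using mz_coeff_gt_Cons[of 1] by simp
  have der: "(?f (Suc n) has_field_derivative ?f n z / (1 - z)) (at z)" if "z \<in> slit_plane" for z
  proof -
    have "z \<noteq> 1" using that by (rule not_one_slit_plane)
    then have "((\<lambda>z. - Ln (1 - z)) has_field_derivative 1 / (1 - z)) (at z)"
      using slit_plane_one_minus[OF that] by (auto intro!: derivative_eq_intros simp: divide_simps)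
    from DERIV_cdivide[OF DERIV_power[OF this, of "Suc n"], of "fact (Suc n)"] show ?thesis
      by (rule DERIV_cong) (simp del: of_nat_Suc)
  qed
  show ?case
    unfolding eq
  proof (rule slit_expansion_euler_integralI)
    show "slit_expansion (\<lambda>z. z * (1 / (1 - z)) * ?f n z)
        (fps_X * Abs_fps (\<lambda>_. 1) * Abs_fps (mz_coeff (>) (replicate n 1)))"
      by (intro slit_intros Suc)
    show "?f (Suc n) holomorphic_on slit_plane"
      using der open_slit_plane holomorphic_on_open by blast
    show "z * deriv (?f (Suc n)) z = z * (1 / (1 - z)) * ?f n z - 0 * (1 / (1 - 0)) * ?f n 0"
      if "z \<in> slit_plane" for z
      using DERIV_imp_deriv[OF der[OF that]] by simp
  qed simp
qed

lemma Li_ones_eq_Ln: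
  assumes "n > 0" "z \<in> slit_plane"
  shows "Li (replicate n 1) z = (- Ln (1 - z)) ^ n / fact n"
  using assms slit_expansion_gt_ones[of n] by (intro Li_eqI) simp_all

theorem theorem11:
  fixes n :: nat
  assumes "n > 0"
  shows "(Le (replicate n 1) (-1) = (\<Sum>p\<in>compositions n. Li p (-1)) \<and>
          (\<Sum>p\<in>compositions n. Li p (-1)) = - Li [n] (1 / 2)) \<and>
         (Li (replicate n 1) (-1) =
            (\<Sum>p\<in>compositions n. (-1) ^ (n - length p) * Le p (-1)) \<and>
          (\<Sum>p\<in>compositions n. (-1) ^ (n - length p) * Le p (-1)) =
            complex_of_real ((- ln 2) ^ n / fact n))"
proof -
  have slit: "- 1 \<in> slit_plane"
    by (auto simp: slit_plane_def complex_eq_iff)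
  have "Ln 2 = of_real (ln 2)"
    using Ln_of_real[of 2] by simp
  then have "Li (replicate n 1) (-1) = complex_of_real ((- ln 2) ^ n / fact n)"
    using Li_ones_eq_Ln[OF assms slit] by simp
  moreover have "Le (replicate n 1) (-1) = - Li [n] (1 / 2)"
    using Le_ones_eq_Li[OF assms slit] by simp
  ultimately show ?thesis
    using Le_ones_eq_sum[OF assms slit] Li_ones_eq_sum[OF assms slit] by simp
qed

end
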